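(* Let $G$ be an abelian group and let $\nu$ be a $G$-valued finite type invariant of virtual knots of degree $n$ (in the virtual sense). Then the restriction of $\nu$ to classical knots is a finite type invariant of degree at most $n$ in the classical sense.
   Context: A virtual knot diagram is a generic immersion of the oriented circle into the plane, whose double points are divided into real crossings (with over/under information) and virtual crossings (without such information). A virtual knot is an equivalence class of virtual knot diagrams under planar isotopies, the usual Reidemeister moves (involving real crossings) and the virtual moves: the analogues of the three Reidemeister moves in which all crossings involved are virtual, and the analogue of the third Reidemeister move in which exactly one of the three crossings is real and the strand not passing through it meets the other two strands at virtual crossings. Classical knot diagrams are virtual knot diagrams without virtual crossings. Virtual finite type invariants. Let $D$ be a virtual knot diagram and $d_1,\dots,d_m$ distinct real crossings of $D$. For $\sigma=(\sigma_1,\dots,\sigma_m)\in\{0,1\}^m$ let $D_\sigma$ be the diagram obtained from $D$ by turning each crossing $d_i$ with $\sigma_i=1$ into a virtual crossing, and let $|\sigma|$ be the number of ones in $\sigma$. The formal sum $\sum_\sigma(-1)^{|\sigma|}D_\sigma$ is called a diagram with $m$ semi-virtual crossings. Let $\mathcal{K}$ be the set of virtual knots. An invariant $\nu:\mathcal{K}\to G$ is extended by linearity to $\mathbb{Z}[\mathcal{K}]$; it is of finite type if for some $n\in\mathbb{N}$ it vanishes on every diagram with more than $n$ semi-virtual crossings, and the minimal such $n$ is the degree of $\nu$. Classical finite type invariants. A $G$-valued invariant $\nu$ of classical knots is of degree $\le n$ in the classical sense if for every classical knot diagram $D$ and every $n+1$ distinct crossings $d_1,\dots,d_{n+1}$ of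 $D$ one has $\sum_{\sigma\in\{0,1\}^{n+1}}(-1)^{|\sigma|}\nu(D_\sigma)=0$, where here $D_\sigma$ is obtained from $D$ by switching (exchanging over- and underpass at) all crossings $d_i$ with $\sigma_i=1$. *)

theory Defs
  imports "HOL-Analysis.Analysis" "HOL-Library.Poly_Mapping"
begin

section \<open>Smooth maps\<close>

primrec C_diff :: "nat \<Rightarrow> ('a::real_normed_vector \<Rightarrow> 'b::real_normed_vector) \<Rightarrow> bool" where
  "C_diff 0 f \<longleftrightarrow> continuous_on UNIV f"
| "C_diff (Suc k) f \<longleftrightarrow>
     (\<forall>x. f differentiable (at x)) \<and> (\<forall>v. C_diff k (\<lambda>x. frechet_derivative f (at x) v))"

definition smooth :: "('a::euclidean_space \<Rightarrow> 'b::euclidean_space) \<Rightarrow> bool" where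
  "smooth f \<longleftrightarrow> (\<forall>k. C_diff k f)"

definition diffeomorphism :: "('a::euclidean_space \<Rightarrow> 'a) \<Rightarrow> bool" where
  "diffeomorphism h \<longleftrightarrow> bij h \<and> smooth h \<and> smooth (inv h)"


section \<open>Virtual knot diagrams\<close>

text \<open>
  The plane is the type of complex numbers, and the oriented circle is the real line modulo 1:
  a closed curve is a map of period 1, and {0..<1} is used as a set of representatives for the
  points of the circle.
\<close>

definition double_points :: "(real \<Rightarrow> complex) \<Rightarrow> complex set" where
  "double_points \<gamma> = {p. \<exists>s\<in>{0..<1}. \<exists>t\<in>{0..<1}. s \<noteq> t \<and> \<gamma> s = p \<and> \<gamma> t = p}"

text \<open>
  Generic: finitely many multiple points, each of them a transverse double point.
\<close>

definition generic_immersion :: "(real \<Rightarrow> complex) \<Rightarrow> bool" where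
  "generic_immersion \<gamma> \<longleftrightarrow>
     smooth \<gamma> \<and>
     (\<forall>s. \<gamma> (s + 1) = \<gamma> s) \<and>
     (\<forall>s. vector_derivative \<gamma> (at s) \<noteq> 0) \<and>
     finite (double_points \<gamma>) \<and>
     (\<forall>p\<in>double_points \<gamma>. card {s\<in>{0..<1}. \<gamma> s = p} = 2) \<and>
     (\<forall>s\<in>{0..<1}. \<forall>t\<in>{0..<1}. s \<noteq> t \<and> \<gamma> s = \<gamma> t \<longrightarrow>
        (\<forall>r::real. vector_derivative \<gamma> (at t) \<noteq> r *\<^sub>R vector_derivative \<gamma> (at s)))"

text \<open>
  The crossings of a diagram are the double points of its curve. The value of \<open>over\<close> at a real
  crossing is \<open>Some s\<close>, where \<open>s\<close> is the parameter in {0..<1} of the overpass; at a virtual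
  crossing, and at every point of the plane that is not a crossing, it is \<open>None\<close>.
\<close>

record vdiagram =
  curve :: "real \<Rightarrow> complex"
  over :: "complex \<Rightarrow> real option"

definition virtual_diagram :: "vdiagram \<Rightarrow> bool" where
  "virtual_diagram D \<longleftrightarrow>
     generic_immersion (curve D) \<and>
     (\<forall>p s. over D p = Some s \<longrightarrow> p \<in> double_points (curve D) \<and> s \<in> {0..<1} \<and> curve D s = p)"

definition real_crossings :: "vdiagram \<Rightarrow> complex set" where
  "real_crossings D = {p \<in> double_points (curve D). over D p \<noteq> None}"

definition virtual_crossings :: "vdiagram \<Rightarrow> complex set" where
  "virtual_crossings D = {p \<in> double_points (curve D). over D p = None}"

definition classical_diagram :: "vdiagram \<Rightarrow> bool" where
  "classical_diagram D \<longleftrightarrow> virtual_diagram D \<and> virtual_crossings D = {}"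

definition virtualize :: "complex set \<Rightarrow> vdiagram \<Rightarrow> vdiagram" where
  "virtualize S D = D\<lparr>over := (\<lambda>p. if p \<in> S then None else over D p)\<rparr>"

definition other_param :: "(real \<Rightarrow> complex) \<Rightarrow> real \<Rightarrow> real" where
  "other_param \<gamma> s = (THE t. t \<in> {0..<1} \<and> t \<noteq> s \<and> \<gamma> t = \<gamma> s)"

definition switch :: "complex set \<Rightarrow> vdiagram \<Rightarrow> vdiagram" where
  "switch S D =
     D\<lparr>over := (\<lambda>p. if p \<in> S then map_option (other_param (curve D)) (over D p) else over D p)\<rparr>"


section \<open>Planar isotopy\<close>

text \<open>
  A smooth ambient isotopy \<open>H\<close> of the plane, together with an orientation preserving
  reparametrization \<open>\<phi>\<close> of the circle, carrying one diagram to the other.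
\<close>

definition circle_reparam :: "(real \<Rightarrow> real) \<Rightarrow> bool" where
  "circle_reparam \<phi> \<longleftrightarrow> smooth \<phi> \<and> (\<forall>s. \<phi> (s + 1) = \<phi> s + 1) \<and> (\<forall>s. deriv \<phi> s > 0)"

definition planar_isotopic :: "vdiagram \<Rightarrow> vdiagram \<Rightarrow> bool" where
  "planar_isotopic D D' \<longleftrightarrow>
     (\<exists>(H :: real \<times> complex \<Rightarrow> complex) \<phi>.
        smooth H \<and> (\<forall>t\<in>{0..1}. diffeomorphism (\<lambda>z. H (t, z))) \<and> (\<forall>z. H (0, z) = z) \<and>
        circle_reparam \<phi> \<and>
        (\<forall>s. curve D' (\<phi> s) = H (1, curve D s)) \<and>
        (\<forall>p. over D' (H (1, p)) = map_option (\<lambda>s. frac (\<phi> s)) (over D p)))"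


section \<open>Reidemeister moves\<close>

text \<open>
  All moves change a diagram only inside a closed disc \<open>B\<close> of the plane, which the curve meets
  in finitely many strands that run from boundary to boundary through the interior. A strand is
  given by its interval \<open>(a, b)\<close> of parameters; since planar isotopy includes rotating the
  parametrization, it is no restriction that the base point of the circle lies outside \<open>B\<close>.

  The two sides of a move are described by the crossings in \<open>B\<close> and the strands they lie on.
  This determines the picture in \<open>B\<close> up to a homeomorphism of the disc: one strand with a single
  self-crossing is a kink, two strands that meet in exactly two points form a bigon, and three
  strands of which any two meet in exactly one point form a triangle.
\<close>

definition closed_disc :: "complex set \<Rightarrow> bool" where
  "closed_disc B \<longleftrightarrow> (\<exists>h. diffeomorphism h \<and> B = h ` cball 0 1)"

definition strands :: "complex set \<Rightarrow> (real \<Rightarrow> complex) \<Rightarrow> (real \<times> real) set \<Rightarrow> bool" where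
  "strands B \<gamma> A \<longleftrightarrow>
     (\<forall>(a, b)\<in>A. 0 < a \<and> a < b \<and> b < 1) \<and>
     disjoint_family_on (\<lambda>(a, b). {a..b}) A \<and>
     {s\<in>{0..1}. \<gamma> s \<in> B} = (\<Union>(a, b)\<in>A. {a..b}) \<and>
     {s\<in>{0..1}. \<gamma> s \<in> interior B} = (\<Union>(a, b)\<in>A. {a<..<b})"

definition agree_outside :: "complex set \<Rightarrow> (real \<times> real) set \<Rightarrow> vdiagram \<Rightarrow> vdiagram \<Rightarrow> bool" where
  "agree_outside B A D D' \<longleftrightarrow>
     closed_disc B \<and> strands B (curve D) A \<and> strands B (curve D') A \<and>
     (\<forall>s\<in>{0..1} - (\<Union>(a, b)\<in>A. {a<..<b}). curve D' s = curve D s) \<and>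
     (\<forall>p. p \<notin> B \<longrightarrow> over D' p = over D p)"

text \<open>First move, from a kink with a crossing of the given kind to an embedded strand.\<close>

definition R1 :: "bool \<Rightarrow> vdiagram \<Rightarrow> vdiagram \<Rightarrow> bool" where
  "R1 is_real D D' \<longleftrightarrow>
     (\<exists>B a b p.
        agree_outside B {(a, b)} D D' \<and>
        p \<in> interior B \<and> double_points (curve D) \<inter> B = {p} \<and>
        (over D p \<noteq> None \<longleftrightarrow> is_real) \<and>
        double_points (curve D') \<inter> B = {})"

text \<open>
  Second move, from a bigon to two disjoint strands. The strand \<open>(a, b)\<close> passes through the
  crossings at the parameters \<open>s\<close> and \<open>s'\<close>, and the strand \<open>(c, d)\<close> at \<open>t\<close> and \<open>t'\<close>. If the
  crossings are real, the strand \<open>(a, b)\<close> is the overpass at both of them.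
\<close>

definition R2 :: "bool \<Rightarrow> vdiagram \<Rightarrow> vdiagram \<Rightarrow> bool" where
  "R2 is_real D D' \<longleftrightarrow>
     (\<exists>B a b c d s s' t t'.
        (a, b) \<noteq> (c, d) \<and> agree_outside B {(a, b), (c, d)} D D' \<and>
        {s, s'} \<subseteq> {a<..<b} \<and> {t, t'} \<subseteq> {c<..<d} \<and> s \<noteq> s' \<and> t \<noteq> t' \<and>
        curve D s = curve D t \<and> curve D s' = curve D t' \<and>
        double_points (curve D) \<inter> B = {curve D s, curve D s'} \<and>
        over D (curve D s) = (if is_real then Some s else None) \<and>
        over D (curve D s') = (if is_real then Some s' else None) \<and>
        double_points (curve D') \<inter> B = {})"

text \<open>
  Three strands with parameter intervals \<open>I\<close>, \<open>J\<close>, \<open>K\<close> that pairwise meet once; \<open>ij\<close> is the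
  parameter on \<open>I\<close> of the crossing with \<open>J\<close>, and so on.
\<close>

definition triangle ::
    "complex set \<Rightarrow> real \<times> real \<Rightarrow> real \<times> real \<Rightarrow> real \<times> real \<Rightarrow> (real \<Rightarrow> complex) \<Rightarrow>
     real \<Rightarrow> real \<Rightarrow> real \<Rightarrow> real \<Rightarrow> real \<Rightarrow> real \<Rightarrow> bool" where
  "triangle B I J K \<gamma> ij ik ji jk ki kj \<longleftrightarrow>
     {ij, ik} \<subseteq> {fst I<..<snd I} \<and> {ji, jk} \<subseteq> {fst J<..<snd J} \<and> {ki, kj} \<subseteq> {fst K<..<snd K} \<and>
     \<gamma> ij = \<gamma> ji \<and> \<gamma> ik = \<gamma> ki \<and> \<gamma> jk = \<gamma> kj \<and>
     double_points \<gamma> \<inter> B = {\<gamma> ij, \<gamma> ik, \<gamma> jk}"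

datatype r3_kind = All_Real | All_Virtual | Mixed

text \<open>
  The crossing information in the third move. If all crossings are real, then \<open>I\<close> is the top,
  \<open>J\<close> the middle and \<open>K\<close> the bottom strand. In the mixed move the only real crossing is that of
  \<open>J\<close> and \<open>K\<close>, with \<open>J\<close> as overpass, and \<open>I\<close> is the strand not passing through it.
\<close>

definition r3_info :: "r3_kind \<Rightarrow> vdiagram \<Rightarrow> real \<Rightarrow> real \<Rightarrow> real \<Rightarrow> bool" where
  "r3_info m D ij ik jk \<longleftrightarrow>
     over D (curve D ij) = (if m = All_Real then Some ij else None) \<and>
     over D (curve D ik) = (if m = All_Real then Some ik else None) \<and>
     over D (curve D jk) = (if m = All_Virtual then None else Some jk)"

text \<open>
  The third move flips the triangle: the order of the two crossings on each strand is reversed.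
\<close>

definition R3 :: "r3_kind \<Rightarrow> vdiagram \<Rightarrow> vdiagram \<Rightarrow> bool" where
  "R3 m D D' \<longleftrightarrow>
     (\<exists>B I J K ij ik ji jk ki kj ij' ik' ji' jk' ki' kj'.
        distinct [I, J, K] \<and> agree_outside B {I, J, K} D D' \<and>
        triangle B I J K (curve D) ij ik ji jk ki kj \<and>
        triangle B I J K (curve D') ij' ik' ji' jk' ki' kj' \<and>
        r3_info m D ij ik jk \<and> r3_info m D' ij' ik' jk' \<and>
        (ij < ik \<longleftrightarrow> ik' < ij') \<and> (ji < jk \<longleftrightarrow> jk' < ji') \<and> (ki < kj \<longleftrightarrow> kj' < ki'))"


section \<open>Virtual and classical knots\<close>

definition classical_move :: "vdiagram \<Rightarrow> vdiagram \<Rightarrow> bool" where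
  "classical_move D D' \<longleftrightarrow>
     classical_diagram D \<and> classical_diagram D' \<and>
     (planar_isotopic D D' \<or> R1 True D D' \<or> R2 True D D' \<or> R3 All_Real D D')"

definition virtual_move :: "vdiagram \<Rightarrow> vdiagram \<Rightarrow> bool" where
  "virtual_move D D' \<longleftrightarrow>
     virtual_diagram D \<and> virtual_diagram D' \<and>
     (planar_isotopic D D' \<or> R1 True D D' \<or> R2 True D D' \<or> R3 All_Real D D' \<or>
      R1 False D D' \<or> R2 False D D' \<or> R3 All_Virtual D D' \<or> R3 Mixed D D')"

definition classical_equiv :: "(vdiagram \<times> vdiagram) set" where
  "classical_equiv =
     {(D, D'). classical_diagram D \<and> classical_diagram D' \<and> equivclp classical_move D D'}"

definition virtual_equiv :: "(vdiagram \<times> vdiagram) set" where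
  "virtual_equiv =
     {(D, D'). virtual_diagram D \<and> virtual_diagram D' \<and> equivclp virtual_move D D'}"

definition classical_knots :: "vdiagram set set" where
  "classical_knots = {D. classical_diagram D} // classical_equiv"

definition virtual_knots :: "vdiagram set set" where
  "virtual_knots = {D. virtual_diagram D} // virtual_equiv"

definition classical_knot_of :: "vdiagram \<Rightarrow> vdiagram set" where
  "classical_knot_of D = classical_equiv `` {D}"

definition virtual_knot_of :: "vdiagram \<Rightarrow> vdiagram set" where
  "virtual_knot_of D = virtual_equiv `` {D}"

text \<open>The virtual knot represented by the diagrams of a classical knot.\<close>

definition classical_to_virtual :: "vdiagram set \<Rightarrow> vdiagram set" where
  "classical_to_virtual K = virtual_equiv `` K"

lemma equiv_virtual_equiv: "equiv {D. virtual_diagram D} virtual_equiv"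
proof (rule equivI)
  show "virtual_equiv \<subseteq> {D. virtual_diagram D} \<times> {D. virtual_diagram D}"
    by (auto simp: virtual_equiv_def)
  show "refl_on {D. virtual_diagram D} virtual_equiv"
    by (auto simp: virtual_equiv_def refl_on_def)
  show "sym virtual_equiv"
    by (auto simp: virtual_equiv_def sym_def intro: equivclp_sym)
  show "trans virtual_equiv"
    by (auto simp: virtual_equiv_def trans_def intro: equivclp_trans)
qed

lemma classical_imp_virtual_equiv:
  assumes "(D, D') \<in> classical_equiv"
  shows "(D, D') \<in> virtual_equiv"
proof -
  have le: "classical_move x y \<Longrightarrow> virtual_move x y" for x y
    by (auto simp: classical_move_def virtual_move_def classical_diagram_def)
  have "equivclp classical_move D D'"
    using assms by (simp add: classical_equiv_def)
  then have "equivclp virtual_move D D'"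
    by (induction rule: equivclp_induct)
       (auto intro: le equivclp_into_equivclp)
  then show ?thesis
    using assms by (simp add: classical_equiv_def virtual_equiv_def classical_diagram_def)
qed

lemma classical_to_virtual_knot_of:
  assumes "classical_diagram D"
  shows "classical_to_virtual (classical_knot_of D) = virtual_knot_of D"
proof -
  have "(D, D) \<in> classical_equiv"
    using assms by (simp add: classical_equiv_def)
  moreover have "virtual_equiv `` {D'} = virtual_equiv `` {D}" if "(D, D') \<in> classical_equiv" for D'
    using equiv_class_eq[OF equiv_virtual_equiv classical_imp_virtual_equiv[OF that]] by simp
  ultimately show ?thesis
    unfolding classical_to_virtual_def classical_knot_of_def virtual_knot_of_def by blast
qed


section \<open>Finite type invariants\<close>

text \<open>
  An invariant with values in \<open>G\<close> is a function on knots; only its values on the elements of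
  \<open>virtual_knots\<close>, respectively \<open>classical_knots\<close>, matter. A choice of \<open>m\<close> distinct crossings
  is a set \<open>C\<close> of \<open>m\<close> crossings, and \<open>\<sigma>\<close> is encoded by the subset \<open>S\<close> of \<open>C\<close> where it is 1.
  The free abelian group on the set of virtual knots is represented by finitely supported
  integer-valued functions.
\<close>

definition int_mult :: "int \<Rightarrow> 'g::ab_group_add \<Rightarrow> 'g" where
  "int_mult k x = (\<Sum>i<nat k. x) - (\<Sum>i<nat (- k). x)"

definition linear_extension ::
    "(vdiagram set \<Rightarrow> 'g::ab_group_add) \<Rightarrow> (vdiagram set \<Rightarrow>\<^sub>0 int) \<Rightarrow> 'g" where
  "linear_extension \<nu> x =
     (\<Sum>K\<in>Poly_Mapping.keys x. int_mult (Poly_Mapping.lookup x K) (\<nu> K))"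

definition semi_virtual :: "vdiagram \<Rightarrow> complex set \<Rightarrow> (vdiagram set \<Rightarrow>\<^sub>0 int)" where
  "semi_virtual D C =
     (\<Sum>S\<in>Pow C. frag_cmul ((- 1) ^ card S) (frag_of (virtual_knot_of (virtualize S D))))"

definition vanishes_above :: "nat \<Rightarrow> (vdiagram set \<Rightarrow> 'g::ab_group_add) \<Rightarrow> bool" where
  "vanishes_above n \<nu> \<longleftrightarrow>
     (\<forall>D C. virtual_diagram D \<and> C \<subseteq> real_crossings D \<and> card C > n \<longrightarrow>
        linear_extension \<nu> (semi_virtual D C) = 0)"

definition virtual_finite_type :: "(vdiagram set \<Rightarrow> 'g::ab_group_add) \<Rightarrow> bool" where
  "virtual_finite_type \<nu> \<longleftrightarrow> (\<exists>n. vanishes_above n \<nu>)"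

definition virtual_degree :: "(vdiagram set \<Rightarrow> 'g::ab_group_add) \<Rightarrow> nat" where
  "virtual_degree \<nu> = (LEAST n. vanishes_above n \<nu>)"

definition classical_degree_le :: "nat \<Rightarrow> (vdiagram set \<Rightarrow> 'g::ab_group_add) \<Rightarrow> bool" where
  "classical_degree_le n \<nu> \<longleftrightarrow>
     (\<forall>D C. classical_diagram D \<and> C \<subseteq> real_crossings D \<and> card C = n + 1 \<longrightarrow>
        (\<Sum>S\<in>Pow C. int_mult ((- 1) ^ card S) (\<nu> (classical_knot_of (switch S D)))) = 0)"

definition restrict_to_classical ::
    "(vdiagram set \<Rightarrow> 'g::ab_group_add) \<Rightarrow> (vdiagram set \<Rightarrow> 'g)" where
  "restrict_to_classical \<nu> K = \<nu> (classical_to_virtual K)"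

end

theory Submission
  imports Defs
begin

text \<open>
  At a single crossing, the difference of a diagram and the switched diagram is the difference of
  the two corresponding diagrams with a semi-virtual crossing, because making the crossing virtual
  forgets which strand was the overpass. Hence the alternating sum over all switchings of a set
  \<open>C\<close> of crossings equals the alternating sum, over \<open>T \<subseteq> C\<close>, of the diagrams obtained by switching
  \<open>T\<close> and making all crossings in \<open>C\<close> semi-virtual.
\<close>

lemma sum_constant_lessThan_add:
  fixes x :: "'g::ab_group_add" and a b :: nat
  shows "(\<Sum>i<a + b. x) = (\<Sum>i<a. x) + (\<Sum>i<b. x)"
  by (induction b) (simp_all add: add.assoc)

text \<open>\<open>int_mult\<close> splits by sign through \<open>nat\<close>. Evaluating it on an
  arbitrary difference of naturals avoids sign cases when proving additivity in the integer.\<close>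

lemma int_mult_diff_of_nat:
  fixes x :: "'g::ab_group_add"
  shows "int_mult (int m - int k) x = (\<Sum>i<m. x) - (\<Sum>i<k. x)"
proof -
  show ?thesis
  proof (cases "k \<le> m")
    case True
    then obtain j where "m = k + j" using le_Suc_ex by blast
    then show ?thesis by (simp add: int_mult_def sum_constant_lessThan_add)
  next
    case False
    then obtain j where "k = m + j" using le_Suc_ex by (metis nat_le_linear)
    then show ?thesis by (simp add: int_mult_def sum_constant_lessThan_add)
  qed
qed

text \<open>Every abelian group is a module over the integers; the interpretation below supplies the
  rules for moving signs through sums.\<close>

lemma module_int_mult: "module (int_mult :: int \<Rightarrow> 'g::ab_group_add \<Rightarrow> 'g)"
proof
  fix a b :: int and x y :: 'g
  show right: "int_mult a (x + y) = int_mult a x + int_mult a y" for a and x y :: 'g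
    by (simp add: int_mult_def sum.distrib)
  show left: "int_mult (a + b) x = int_mult a x + int_mult b x" for a b and x :: 'g
  proof -
    obtain m k m' k' where ab: "a = int m - int k" "b = int m' - int k'"
      by (metis int_diff_cases)
    then have "a + b = int (m + m') - int (k + k')" by simp
    then show ?thesis
      unfolding ab by (simp only: int_mult_diff_of_nat sum_constant_lessThan_add) simp
  qed
  show one: "int_mult 1 x = x" for x :: 'g
    by (simp add: int_mult_def)
  have zero: "int_mult 0 x = 0" for x :: 'g
    by (simp add: int_mult_def)
  have left_diff: "int_mult (a - b) x = int_mult a x - int_mult b x" for a b and x :: 'g
    using left[of "a - b" b x] by simp
  show "int_mult a (int_mult b x) = int_mult (a * b) x"
    by (induction a rule: int_induct[where k = 0])
       (simp_all add: zero one left left_diff distrib_right left_diff_distrib)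
qed

interpretation int_mult: module "int_mult :: int \<Rightarrow> 'g::ab_group_add \<Rightarrow> 'g"
  by (rule module_int_mult)

text \<open>Added indices have coefficient 0. This gives \<open>x\<close>, \<open>y\<close> and
  \<open>x + y\<close> a common index set, although cancellation may shrink the support of the
  sum.\<close>

lemma linear_extension_superset:
  assumes "finite A" "Poly_Mapping.keys x \<subseteq> A"
  shows "linear_extension \<nu> x = (\<Sum>K\<in>A. int_mult (Poly_Mapping.lookup x K) (\<nu> K))"
  unfolding linear_extension_def using assms
  by (intro sum.mono_neutral_left) (auto simp: in_keys_iff)

lemma linear_extension_zero: "linear_extension \<nu> 0 = 0"
  by (simp add: linear_extension_def)

lemma linear_extension_add:
  "linear_extension \<nu> (x + y) = linear_extension \<nu> x + linear_extension \<nu> y"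
  using Poly_Mapping.keys_add[of x y]
  by (simp add: linear_extension_superset[where A = "Poly_Mapping.keys x \<union> Poly_Mapping.keys y"]
      lookup_add int_mult.scale_left_distrib sum.distrib)

lemma linear_extension_sum:
  "linear_extension \<nu> (\<Sum>i\<in>I. f i) = (\<Sum>i\<in>I. linear_extension \<nu> (f i))"
  by (induction I rule: infinite_finite_induct)
     (simp_all add: linear_extension_zero linear_extension_add)

lemma linear_extension_cmul_of:
  "linear_extension \<nu> (frag_cmul k (frag_of K)) = int_mult k (\<nu> K)"
  using keys_cmul[of k "frag_of K"]
  \<comment> \<open>For \<open>k = 0\<close> the support is empty, so \<open>{K}\<close> serves as a
    superset of it.\<close>
  by (subst linear_extension_superset[where A = "{K}"]) auto

text \<open>Different \<open>S\<close> may give the same virtual knot, so terms can merge or cancel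
  in the free abelian group; linearity still yields a sum indexed by \<open>S\<close>.\<close>

lemma linear_extension_semi_virtual:
  "linear_extension \<nu> (semi_virtual D C) =
     (\<Sum>S\<in>Pow C. int_mult ((- 1) ^ card S) (\<nu> (virtual_knot_of (virtualize S D))))"
  by (simp add: semi_virtual_def linear_extension_sum linear_extension_cmul_of)

text \<open>The subsets of \<open>C\<close> pair off as \<open>T\<close> and
  \<open>insert c T\<close>, with equal values of \<open>h\<close> and opposite signs.\<close>

lemma sum_Pow_alternating_eq_0:
  fixes h :: "'a set \<Rightarrow> 'g::ab_group_add"
  assumes "finite C" "c \<in> C"
    and h: "\<And>T. T \<subseteq> C \<Longrightarrow> c \<notin> T \<Longrightarrow> h (insert c T) = h T"
  shows "(\<Sum>T\<in>Pow C. int_mult ((- 1) ^ card T) (h T)) = 0"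
proof -
  define E where "E = C - {c}"
  have C: "C = insert c E" and c: "c \<notin> E" and fin: "finite E"
    using assms(1,2) by (auto simp: E_def)
  have inj: "inj_on (insert c) (Pow E)"
    using c by (auto simp: inj_on_def)
  have "(\<Sum>T\<in>insert c ` Pow E. int_mult ((- 1) ^ card T) (h T)) =
      (\<Sum>T\<in>Pow E. - int_mult ((- 1) ^ card T) (h T))"
    unfolding sum.reindex[OF inj] o_def
  proof (intro sum.cong refl)
    fix T assume "T \<in> Pow E"
    then have "T \<subseteq> C" "c \<notin> T" "finite T"
      using C c fin finite_subset by auto
    then show "int_mult ((- 1) ^ card (insert c T)) (h (insert c T)) =
        - int_mult ((- 1) ^ card T) (h T)"
      by (simp add: h)
  qed
  then show ?thesis
    unfolding C Pow_insert using fin c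
    by (subst sum.union_disjoint) (auto simp: sum_negf)
qed

text \<open>A double point of a generic immersion has exactly two parameters, so the definite
  description in \<open>other_param\<close> is well defined.\<close>

lemma other_param:
  assumes "generic_immersion \<gamma>" "\<gamma> s \<in> double_points \<gamma>" "s \<in> {0..<1}"
  shows "other_param \<gamma> s \<in> {0..<1}" "\<gamma> (other_param \<gamma> s) = \<gamma> s"
proof -
  have "card {t\<in>{0..<1}. \<gamma> t = \<gamma> s} = 2"
    using assms(1,2) by (simp add: generic_immersion_def)
  then obtain u v where uv: "{t\<in>{0..<1}. \<gamma> t = \<gamma> s} = {u, v}" "u \<noteq> v"
    by (auto simp: card_2_iff)
  moreover have "s \<in> {t\<in>{0..<1}. \<gamma> t = \<gamma> s}"
    using assms(3) by simp
  ultimately have "\<exists>!t. t \<in> {t\<in>{0..<1}. \<gamma> t = \<gamma> s} \<and> t \<noteq> s"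
    by auto
  then have "\<exists>!t. t \<in> {0..<1} \<and> t \<noteq> s \<and> \<gamma> t = \<gamma> s"
    by (simp add: conj_ac)
  from theI'[OF this]
  show "other_param \<gamma> s \<in> {0..<1}" "\<gamma> (other_param \<gamma> s) = \<gamma> s"
    by (auto simp: other_param_def)
qed

lemma virtual_diagram_switch:
  assumes "virtual_diagram D"
  shows "virtual_diagram (switch T D)"
proof -
  have "p \<in> double_points (curve D) \<and> s \<in> {0..<1} \<and> curve D s = p"
    if s: "over (switch T D) p = Some s" for p s
  proof (cases "p \<in> T")
    case True
    then obtain r where r: "over D p = Some r" "s = other_param (curve D) r"
      using s by (auto simp: switch_def)
    then have "p \<in> double_points (curve D)" "r \<in> {0..<1}" "curve D r = p"
      using assms by (auto simp: virtual_diagram_def)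
    then show ?thesis
      using other_param[of "curve D" r] assms r(2) by (simp add: virtual_diagram_def)
  next
    case False
    then show ?thesis
      using s assms by (simp add: switch_def virtual_diagram_def)
  qed
  then show ?thesis
    using assms by (simp add: virtual_diagram_def switch_def)
qed

lemma real_crossings_switch: "real_crossings (switch T D) = real_crossings D"
  by (auto simp: real_crossings_def switch_def)

lemma classical_diagram_switch:
  assumes "classical_diagram D"
  shows "classical_diagram (switch T D)"
proof -
  have "virtual_crossings (switch T D) = virtual_crossings D"
    by (auto simp: virtual_crossings_def switch_def)
  then show ?thesis
    using assms by (simp add: classical_diagram_def virtual_diagram_switch)
qed

lemma virtualize_empty: "virtualize {} D = D"
  by (simp add: virtualize_def)

lemma virtualize_switch_insert:
  assumes "c \<in> S"
  shows "virtualize S (switch (insert c T) D) = virtualize S (switch T D)"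
  using assms by (cases D) (auto simp: virtualize_def switch_def fun_eq_iff)

text \<open>All crossings are treated at once: after exchanging the two sums, only the term
  \<open>S = {}\<close> survives, and it is the left-hand side.\<close>

lemma alternating_sum_switch:
  fixes f :: "vdiagram \<Rightarrow> 'g::ab_group_add"
  assumes "finite C"
  shows "(\<Sum>T\<in>Pow C. int_mult ((- 1) ^ card T) (f (switch T D))) =
    (\<Sum>T\<in>Pow C. int_mult ((- 1) ^ card T)
       (\<Sum>S\<in>Pow C. int_mult ((- 1) ^ card S) (f (virtualize S (switch T D)))))"
proof -
  let ?g = "\<lambda>S. \<Sum>T\<in>Pow C. int_mult ((- 1) ^ card T) (f (virtualize S (switch T D)))"
  have vanish: "?g S = 0" if S: "S \<in> Pow C - {{}}" for S
  proof -
    \<comment> \<open>Since \<open>c\<close> is made virtual, switching it first has no effect, so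
      the sum over \<open>T\<close> cancels in pairs.\<close>
    obtain c where "c \<in> S" "c \<in> C" using S by blast
    have "f (virtualize S (switch (insert c T) D)) = f (virtualize S (switch T D))" for T
      by (simp only: virtualize_switch_insert[OF \<open>c \<in> S\<close>])
    then show ?thesis
      by (rule sum_Pow_alternating_eq_0[OF assms \<open>c \<in> C\<close>])
  qed
  have "(\<Sum>T\<in>Pow C. int_mult ((- 1) ^ card T)
        (\<Sum>S\<in>Pow C. int_mult ((- 1) ^ card S) (f (virtualize S (switch T D))))) =
      (\<Sum>T\<in>Pow C. \<Sum>S\<in>Pow C. int_mult ((- 1) ^ card S)
        (int_mult ((- 1) ^ card T) (f (virtualize S (switch T D)))))"
    by (simp only: int_mult.scale_sum_right int_mult.scale_left_commute)
  also have "\<dots> = (\<Sum>S\<in>Pow C. int_mult ((- 1) ^ card S) (?g S))"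
    by (subst sum.swap) (simp only: int_mult.scale_sum_right)
  also have "\<dots> = (\<Sum>S\<in>{{}}. int_mult ((- 1) ^ card S) (?g S))"
    using assms vanish by (intro sum.mono_neutral_right) simp_all
  also have "\<dots> = ?g {}"
    by simp
  finally show ?thesis
    by (simp add: virtualize_empty)
qed

theorem mainTheorem4:
  fixes \<nu> :: "vdiagram set \<Rightarrow> 'g::ab_group_add" and n :: nat
  assumes "virtual_finite_type \<nu>" and "virtual_degree \<nu> = n"
  shows "classical_degree_le n (restrict_to_classical \<nu>)"
  unfolding classical_degree_le_def
proof (intro allI impI, elim conjE)
  fix D C
  assume D: "classical_diagram D" and C: "C \<subseteq> real_crossings D" and card: "card C = n + 1"
  \<comment> \<open>An infinite set has \<open>card\<close> 0, which differs from
    \<open>n + 1\<close>.\<close>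
  have fin: "finite C"
    using card card.infinite by fastforce
  \<comment> \<open>Finite type provides some bound, so the \<open>LEAST\<close> in the degree is
    attained.\<close>
  have "vanishes_above n \<nu>"
    using assms LeastI_ex[of "\<lambda>n. vanishes_above n \<nu>"]
    by (simp add: virtual_finite_type_def virtual_degree_def)
  \<comment> \<open>Switching preserves the set of real crossings, so \<open>C\<close> remains an
    admissible choice of more than \<open>n\<close> crossings for each \<open>T\<close>.\<close>
  then have vanish: "linear_extension \<nu> (semi_virtual (switch T D) C) = 0" for T
    using D C card
    by (simp add: vanishes_above_def classical_diagram_def virtual_diagram_switch
        real_crossings_switch)
  have "(\<Sum>T\<in>Pow C. int_mult ((- 1) ^ card T)
        (restrict_to_classical \<nu> (classical_knot_of (switch T D)))) =
      (\<Sum>T\<in>Pow C. int_mult ((- 1) ^ card T) (\<nu> (virtual_knot_of (switch T D))))"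
    using D by (simp add: restrict_to_classical_def classical_to_virtual_knot_of
        classical_diagram_switch)
  also have "\<dots> = (\<Sum>T\<in>Pow C. int_mult ((- 1) ^ card T)
      (linear_extension \<nu> (semi_virtual (switch T D) C)))"
    unfolding linear_extension_semi_virtual
    by (rule alternating_sum_switch[OF fin, where f = "\<lambda>D. \<nu> (virtual_knot_of D)"])
  finally show "(\<Sum>T\<in>Pow C. int_mult ((- 1) ^ card T)
        (restrict_to_classical \<nu> (classical_knot_of (switch T D)))) = 0"
    by (simp add: vanish)
qed

end
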